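(* Consider the generic algorithm with sparse group lasso described in the context, with step sizes $\{\alpha_t>0\}_{t=0}^T$, starting point $x_1\in\mathbb{R}^n$, and functions $\{\phi_t,\psi_t\}_{t=1}^T$, where the matrices $V_t$ ($1\le t\le T$) are diagonal and positive definite. If the regularization terms vanish, i.e. $\lambda_1=\lambda_{21}=\lambda_2=0$, then the algorithm is equivalent to the general adaptive update: for every $t=1,\dots,T$ its iterates satisfy $$x_{t+1}=x_t-\alpha_t\,\sqrt{V_t}^{\,-1}m_t .$$
   Context: Generic algorithm. Input: parameters $\lambda_1,\lambda_{21},\lambda_2\ge0$, $x_1\in\mathbb{R}^n$, step sizes $\{\alpha_t>0\}_{t=0}^T$, loss functions $f_t$, sequences of functions $\{\phi_t,\psi_t\}_{t=1}^T$ ($\phi_t$ vector-valued in $\mathbb{R}^n$, $\psi_t$ valued in diagonal $n\times n$ matrices); a partition of $\{1,\dots,n\}$ into groups. Initialize $z_0=\mathbf 0$, $V_0=\mathbf 0$. For $t=1,\dots,T$: 1. $g_t=\nabla f_t(x_t)$; 2. $m_t=\phi_t(g_1,\dots,g_t)$ and $V_t=\psi_t(g_1,\dots,g_t)$; 3. $\frac{Q_t}{\alpha_t}=\frac{\sqrt{V_t}}{\alpha_t}-\frac{\sqrt{V_{t-1}}}{\alpha_{t-1}}$; 4. $z_t=z_{t-1}+m_t-\frac{Q_t}{\alpha_t}x_t$; 5. for each $i$: $s_{t,i}=0$ if $|z_{t,i}|\le\lambda_1$, and $s_{t,i}=\operatorname{sign}(z_{t,i})\lambda_1-z_{t,i}$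 otherwise; 6. for each group $g$ of size $d_{x^g}$, the subvector of $x_{t+1}$ on $g$ is the subvector on $g$ of $\big(\frac{\sqrt{V_t}}{\alpha_t}+2\lambda_2\mathbb{I}\big)^{-1}\max\big(1-\frac{\sqrt{d_{x^g}}\lambda_{21}}{\|s_t^g\|_2},0\big)s_t$, where $s_t^g$ is the subvector of $s_t$ on $g$ (interpreted as $0$ when $s_t^g=0$; when $\lambda_{21}=0$ the max factor is $1$). Here $\sqrt{V_t}=V_t^{1/2}$ and $\mathbb{I}$ is the identity matrix. *)

theory Defs
  imports "HOL-Analysis.Analysis"
begin

definition diagonal_matrix :: "real ^ 'n ^ 'n \<Rightarrow> bool" where
  "diagonal_matrix A \<longleftrightarrow> (\<forall>i j. i \<noteq> j \<longrightarrow> A $ i $ j = 0)"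

definition psd_matrix :: "real ^ 'n ^ 'n \<Rightarrow> bool" where
  "psd_matrix A \<longleftrightarrow> transpose A = A \<and> (\<forall>v. v \<bullet> (A *v v) \<ge> 0)"

definition pos_def_matrix :: "real ^ 'n ^ 'n \<Rightarrow> bool" where
  "pos_def_matrix A \<longleftrightarrow> transpose A = A \<and> (\<forall>v. v \<noteq> 0 \<longrightarrow> v \<bullet> (A *v v) > 0)"

text \<open>The principal square root. It is unspecified unless the argument is positive semidefinite;
  for diagonal arguments it is the entrywise root, see \<open>sqrt_matrix_diagonal\<close> below.\<close>

definition sqrt_matrix :: "real ^ 'n ^ 'n \<Rightarrow> real ^ 'n ^ 'n" where
  "sqrt_matrix A = (THE R. psd_matrix R \<and> R ** R = A)"

lemma sqrt_matrix_diagonal: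
  fixes A :: "real ^ 'n ^ 'n"
  assumes diag: "diagonal_matrix A" and nonneg: "\<And>i. A $ i $ i \<ge> 0"
  shows "sqrt_matrix A = (\<chi> i j. if i = j then sqrt (A $ i $ i) else 0)"
proof -
  define S :: "real ^ 'n ^ 'n" where "S = (\<chi> i j. if i = j then sqrt (A $ i $ i) else 0)"
  have Sv: "S *v v = (\<chi> i. sqrt (A $ i $ i) * v $ i)" for v
    by (simp add: S_def matrix_vector_mult_def vec_eq_iff if_distrib [of "\<lambda>c. c * _"] cong: if_cong)
  have S_psd: "psd_matrix S"
    unfolding psd_matrix_def
  proof (intro conjI allI)
    show "transpose S = S" by (auto simp: S_def transpose_def vec_eq_iff)
    show "v \<bullet> (S *v v) \<ge> 0" for v
      unfolding Sv inner_vec_def using nonneg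
      by (auto intro!: sum_nonneg simp: mult.left_commute [of "v $ _"])
  qed
  have SS: "S ** S = A"
    using diag nonneg
    by (auto simp: S_def matrix_matrix_mult_def vec_eq_iff diagonal_matrix_def
        if_distrib [of "\<lambda>c. c * _"] cong: if_cong)
  have "R = S" if R: "psd_matrix R" and RR: "R ** R = A" for R
  proof -
    have RA: "R ** A = A ** R" by (simp add: RR [symmetric] matrix_mul_assoc)
    have left: "(R ** A) $ i $ j = R $ i $ j * A $ j $ j" for i j
    proof -
      have "(R ** A) $ i $ j = (\<Sum>k\<in>UNIV. if k = j then R $ i $ j * A $ j $ j else 0)"
        unfolding matrix_matrix_mult_def vec_lambda_beta
        using diag by (intro sum.cong) (auto simp: diagonal_matrix_def)
      then show ?thesis by simp
    qed
    have right: "(A ** R) $ i $ j = A $ i $ i * R $ i $ j" for i j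
    proof -
      have "(A ** R) $ i $ j = (\<Sum>k\<in>UNIV. if k = i then A $ i $ i * R $ i $ j else 0)"
        unfolding matrix_matrix_mult_def vec_lambda_beta
        using diag by (intro sum.cong) (auto simp: diagonal_matrix_def)
      then show ?thesis by simp
    qed
    have comm: "R $ i $ j * A $ j $ j = A $ i $ i * R $ i $ j" for i j
      using left [of i j] right [of i j] RA by auto
    have commS: "R $ i $ j * sqrt (A $ j $ j) = sqrt (A $ i $ i) * R $ i $ j" for i j
      using comm [of i j] by (cases "R $ i $ j = 0") auto
    have RS: "R ** S = S ** R"
      using commS by (simp add: S_def matrix_matrix_mult_def vec_eq_iff
          if_distrib [of "\<lambda>c. c * _"] if_distrib [of "\<lambda>c. _ * c"] cong: if_cong)
    have "R *v u = S *v u" for u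
    proof -
      define w where "w = R *v u - S *v u"
      have "R *v w + S *v w = (R ** R) *v u - (R ** S) *v u + ((S ** R) *v u - (S ** S) *v u)"
        by (simp add: w_def matrix_vector_mult_diff_distrib matrix_vector_mul_assoc)
      then have "R *v w + S *v w = 0" by (simp add: RS RR SS)
      then have "w \<bullet> (R *v w) + w \<bullet> (S *v w) = 0"
        by (metis inner_add_right inner_zero_right)
      moreover have "w \<bullet> (R *v w) \<ge> 0" "w \<bullet> (S *v w) \<ge> 0"
        using R S_psd by (auto simp: psd_matrix_def)
      ultimately have "w \<bullet> (S *v w) = 0" by linarith
      moreover have "w \<bullet> (S *v w) = (\<Sum>i\<in>UNIV. sqrt (A $ i $ i) * (w $ i)\<^sup>2)"
        by (simp add: Sv inner_vec_def power2_eq_square mult_ac)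
      ultimately have "(\<Sum>i\<in>UNIV. sqrt (A $ i $ i) * (w $ i)\<^sup>2) = 0"
        by simp
      then have "\<forall>i\<in>UNIV. sqrt (A $ i $ i) * (w $ i)\<^sup>2 = 0"
        using nonneg by (subst (asm) sum_nonneg_eq_0_iff) auto
      then have Sw: "S *v w = 0" by (auto simp: Sv vec_eq_iff)
      with \<open>R *v w + S *v w = 0\<close> have Rw: "R *v w = 0" by simp
      have sym: "(M *v u) \<bullet> w = u \<bullet> (M *v w)" if "transpose M = M" for M :: "real ^ 'n ^ 'n"
      proof -
        have "(M *v u) \<bullet> w = (transpose M *v u) \<bullet> w" by (simp only: that)
        then show ?thesis by (simp only: transpose_matrix_vector dot_lmul_matrix)
      qed
      have "w \<bullet> w = (R *v u) \<bullet> w - (S *v u) \<bullet> w"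
        by (simp add: w_def inner_diff_left)
      also have "\<dots> = u \<bullet> (R *v w) - u \<bullet> (S *v w)"
        using R S_psd sym [of R] sym [of S] unfolding psd_matrix_def by linarith
      finally have "w = 0" by (simp add: Rw Sw)
      then show ?thesis by (simp add: w_def)
    qed
    then show ?thesis by (simp add: matrix_eq)
  qed
  then show ?thesis
    unfolding sqrt_matrix_def S_def [symmetric] using S_psd SS by (intro the_equality) blast+
qed

text \<open>\<open>s\<close> as a function of \<open>z\<close>; \<^const>\<open>sgn\<close> on \<^typ>\<open>real\<close> is the sign.\<close>

definition shrink :: "real \<Rightarrow> real ^ 'n \<Rightarrow> real ^ 'n" where
  "shrink l1 z = (\<chi> i. if \<bar>z $ i\<bar> \<le> l1 then 0 else sgn (z $ i) * l1 - z $ i)"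

definition group_norm :: "'n::finite set \<Rightarrow> real ^ 'n \<Rightarrow> real" where
  "group_norm G v = L2_set (\<lambda>i. v $ i) G"

text \<open>The vector whose restriction to the group \<open>G\<close> is the new iterate on \<open>G\<close>;
  the case distinction covers a vanishing subvector of \<open>s\<close>, where the quotient has no meaning.\<close>

definition group_step ::
  "real \<Rightarrow> real \<Rightarrow> real \<Rightarrow> real ^ 'n ^ 'n \<Rightarrow> real ^ 'n \<Rightarrow> 'n set \<Rightarrow> real ^ 'n"
where
  "group_step l21 l2 a V s G =
     (if group_norm G s = 0 then 0
      else matrix_inv (sqrt_matrix V /\<^sub>R a + (2 * l2) *\<^sub>R mat 1)
             *v (max (1 - sqrt (real (card G)) * l21 / group_norm G s) 0 *\<^sub>R s))"

text \<open>The input data. The functions \<open>\<phi> t\<close> and \<open>\<psi> t\<close> take the list of the first \<open>t\<close> gradients.\<close>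

locale sparse_group_lasso_input =
  fixes T :: nat
    and groups :: "'n::finite set set"
    and l1 l21 l2 :: real
    and \<alpha> :: "nat \<Rightarrow> real"
    and \<psi> :: "nat \<Rightarrow> (real ^ 'n) list \<Rightarrow> real ^ 'n ^ 'n"
  assumes groups: "partition_on UNIV groups"
    and l1_nonneg: "0 \<le> l1" and l21_nonneg: "0 \<le> l21" and l2_nonneg: "0 \<le> l2"
    and \<alpha>_pos: "\<And>t. t \<le> T \<Longrightarrow> 0 < \<alpha> t"
    and \<psi>_diagonal: "\<And>t gs. 1 \<le> t \<Longrightarrow> t \<le> T \<Longrightarrow> length gs = t \<Longrightarrow> diagonal_matrix (\<psi> t gs)"

text \<open>The sequences \<open>x, g, m, V, Q, z, s\<close> are produced by running the algorithm for \<open>T\<close> rounds.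
  In particular, \<open>f t\<close> is differentiable at \<open>x t\<close>.\<close>

locale sparse_group_lasso_run = sparse_group_lasso_input T groups l1 l21 l2 \<alpha> \<psi>
  for T :: nat
    and groups :: "'n::finite set set"
    and l1 l21 l2 :: real
    and \<alpha> :: "nat \<Rightarrow> real"
    and \<psi> :: "nat \<Rightarrow> (real ^ 'n) list \<Rightarrow> real ^ 'n ^ 'n" +
  fixes \<phi> :: "nat \<Rightarrow> (real ^ 'n) list \<Rightarrow> real ^ 'n"
    and f :: "nat \<Rightarrow> real ^ 'n \<Rightarrow> real"
    and x1 :: "real ^ 'n"
    and x g m :: "nat \<Rightarrow> real ^ 'n"
    and V Q :: "nat \<Rightarrow> real ^ 'n ^ 'n"
    and z s :: "nat \<Rightarrow> real ^ 'n"
  assumes x_init: "x 1 = x1"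
    and z_init: "z 0 = 0"
    and V_init: "V 0 = 0"
    and g_step: "\<And>t. 1 \<le> t \<Longrightarrow> t \<le> T \<Longrightarrow> GDERIV (f t) (x t) :> g t"
    and m_step: "\<And>t. 1 \<le> t \<Longrightarrow> t \<le> T \<Longrightarrow> m t = \<phi> t (map g [1..<Suc t])"
    and V_step: "\<And>t. 1 \<le> t \<Longrightarrow> t \<le> T \<Longrightarrow> V t = \<psi> t (map g [1..<Suc t])"
    and Q_step: "\<And>t. 1 \<le> t \<Longrightarrow> t \<le> T \<Longrightarrow>
      Q t /\<^sub>R \<alpha> t = sqrt_matrix (V t) /\<^sub>R \<alpha> t - sqrt_matrix (V (t - 1)) /\<^sub>R \<alpha> (t - 1)"
    and z_step: "\<And>t. 1 \<le> t \<Longrightarrow> t \<le> T \<Longrightarrow> z t = z (t - 1) + m t - (Q t /\<^sub>R \<alpha> t) *v x t"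
    and s_step: "\<And>t. 1 \<le> t \<Longrightarrow> t \<le> T \<Longrightarrow> s t = shrink l1 (z t)"
    and x_step: "\<And>t G i. 1 \<le> t \<Longrightarrow> t \<le> T \<Longrightarrow> G \<in> groups \<Longrightarrow> i \<in> G \<Longrightarrow>
      x (t + 1) $ i = group_step l21 l2 (\<alpha> t) (V t) (s t) G $ i"

end

theory Submission
  imports Defs
begin

text \<open>Write \<open>A t = sqrt (V t) / \<alpha> t\<close>. Without regularization \<open>s t = - z t\<close> and every shrinkage factor is 1, so
  \<open>A t (x (t + 1)) = - z t\<close>; this also holds at \<open>t = 0\<close>, where both sides vanish. Substituting it for
  \<open>z (t - 1)\<close> in the recursion for \<open>z\<close> cancels the terms with \<open>A (t - 1)\<close> and leaves
  \<open>z t = m t - A t (x t)\<close>.\<close>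

text \<open>\<open>matrix_inv\<close> is defined by choice; uniqueness of two-sided inverses pins
  down the chosen value.\<close>

lemma matrix_inv_eqI:
  fixes A :: "'a::semiring_1 ^ 'n ^ 'm"
  assumes "A ** B = mat 1" "B ** A = mat 1"
  shows "matrix_inv A = B"
  unfolding matrix_inv_def
proof (rule some_equality)
  show "A ** B = mat 1 \<and> B ** A = mat 1"
    using assms by blast
  show "C = B" if "A ** C = mat 1 \<and> C ** A = mat 1" for C
    by (metis assms that matrix_mul_assoc matrix_mul_lid matrix_mul_rid)
qed

lemma diagonal_matrix_mult_vec:
  fixes d :: "'n::finite \<Rightarrow> real"
  shows "(\<chi> i j. if i = j then d i else 0) *v v = (\<chi> i. d i * v $ i)"
  by (simp add: matrix_vector_mult_def vec_eq_iff if_distrib [of "\<lambda>c. c * _"] cong: if_cong)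

lemma matrix_inv_diagonal:
  fixes d :: "'n::finite \<Rightarrow> real"
  assumes "\<And>i. d i \<noteq> 0"
  shows "matrix_inv (\<chi> i j. if i = j then d i else 0) = (\<chi> i j. if i = j then inverse (d i) else 0)"
  by (rule matrix_inv_eqI)
    (auto simp: assms matrix_eq diagonal_matrix_mult_vec vec_eq_iff
      simp flip: matrix_vector_mul_assoc)

text \<open>Evaluating the quadratic form at the standard basis vector \<open>axis i 1\<close> picks
  out the diagonal entry.\<close>

lemma pos_def_matrix_diagonal_entry:
  fixes A :: "real ^ 'n ^ 'n"
  assumes "pos_def_matrix A"
  shows "0 < A $ i $ i"
proof -
  have "0 < axis i 1 \<bullet> (A *v axis i 1)"
    using assms by (simp add: pos_def_matrix_def axis_eq_0_iff)
  then show ?thesis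
    by (simp add: inner_axis' matrix_vector_mult_basis column_def)
qed

text \<open>With threshold 0 the zero branch is taken only where the entry of \<open>z\<close> is
  itself 0, so it agrees with negation; elsewhere the sign is multiplied by 0.\<close>

lemma shrink_0: "shrink 0 z = - z"
  by (simp add: shrink_def vec_eq_iff)

lemma group_norm_eq_0_iff: "group_norm G v = 0 \<longleftrightarrow> (\<forall>i\<in>G. v $ i = 0)"
  by (simp add: group_norm_def L2_set_eq_0_iff)

text \<open>If the subvector of \<open>s\<close> on \<open>G\<close> is nonzero, the max factor is 1
  and a diagonal matrix is inverted. If it vanishes, the default value 0 fits the same formula,
  because \<open>i\<close> lies in \<open>G\<close> and hence \<open>s $ i = 0\<close>.\<close>

lemma group_step_unregularized:
  fixes V :: "real ^ 'n ^ 'n"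
  assumes "diagonal_matrix V" and pos: "\<And>i. 0 < V $ i $ i" and a: "0 < a" and i: "i \<in> G"
  shows "group_step 0 0 a V s G $ i = a / sqrt (V $ i $ i) * s $ i"
proof -
  have "sqrt_matrix V = (\<chi> i j. if i = j then sqrt (V $ i $ i) else 0)"
    using assms by (intro sqrt_matrix_diagonal) (auto intro: less_imp_le)
  then have "sqrt_matrix V /\<^sub>R a + (2 * 0) *\<^sub>R mat 1 =
      (\<chi> i j. if i = j then sqrt (V $ i $ i) / a else 0)"
    by (simp add: vec_eq_iff divide_inverse)
  moreover have "sqrt (V $ j $ j) / a \<noteq> 0" for j
    using pos [of j] a by simp
  ultimately show ?thesis
    using i by (auto simp: group_step_def group_norm_eq_0_iff matrix_inv_diagonal
        diagonal_matrix_mult_vec)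
qed

theorem theorem2:
  fixes T :: nat
    and groups :: "'n::finite set set"
    and l1 l21 l2 :: real
    and \<alpha> :: "nat \<Rightarrow> real"
    and \<psi> :: "nat \<Rightarrow> (real ^ 'n) list \<Rightarrow> real ^ 'n ^ 'n"
    and \<phi> :: "nat \<Rightarrow> (real ^ 'n) list \<Rightarrow> real ^ 'n"
    and f :: "nat \<Rightarrow> real ^ 'n \<Rightarrow> real"
    and x1 :: "real ^ 'n"
    and x g m :: "nat \<Rightarrow> real ^ 'n"
    and V Q :: "nat \<Rightarrow> real ^ 'n ^ 'n"
    and z s :: "nat \<Rightarrow> real ^ 'n"
  assumes run: "sparse_group_lasso_run T groups l1 l21 l2 \<alpha> \<psi> \<phi> f x1 x g m V Q z s"
    and V_pos_def: "\<And>t. 1 \<le> t \<Longrightarrow> t \<le> T \<Longrightarrow> pos_def_matrix (V t)"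
    and no_regularization: "l1 = 0" "l21 = 0" "l2 = 0"
  shows "\<forall>t\<in>{1..T}. x (t + 1) = x t - \<alpha> t *\<^sub>R (matrix_inv (sqrt_matrix (V t)) *v m t)"
proof
  interpret sparse_group_lasso_run T groups l1 l21 l2 \<alpha> \<psi> \<phi> f x1 x g m V Q z s
    by (fact run)
  define r where "r t i = sqrt (V t $ i $ i)" for t i
  have diag: "diagonal_matrix (V t)" if "t \<le> T" for t
  proof (cases "t = 0")
    case True
    then show ?thesis by (simp add: V_init diagonal_matrix_def)
  next
    case False
    then show ?thesis using that by (simp add: V_step \<psi>_diagonal)
  qed
  have pos: "0 < V t $ i $ i" if "1 \<le> t" "t \<le> T" for t i
    using V_pos_def that by (blast intro: pos_def_matrix_diagonal_entry)
  \<comment> \<open>Index 0 is included, with all roots 0, since the first round subtracts the root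
    of \<open>V 0\<close>.\<close>
  have root: "sqrt_matrix (V t) = (\<chi> i j. if i = j then r t i else 0)" if "t \<le> T" for t
  proof -
    have "0 \<le> V t $ i $ i" for i
      using pos [of t i] that by (cases "t = 0") (auto simp: V_init)
    then show ?thesis
      unfolding r_def using diag that by (intro sqrt_matrix_diagonal) auto
  qed
  have x_next: "x (t + 1) $ i = - (\<alpha> t / r t i * z t $ i)" if t: "1 \<le> t" "t \<le> T" for t i
  proof -
    \<comment> \<open>The new iterate is prescribed group by group; the groups cover all
      coordinates, so each one is determined.\<close>
    obtain G where "G \<in> groups" "i \<in> G"
      using partition_onD1 [OF groups] by blast
    then show ?thesis
      using t by (simp add: x_step s_step no_regularization shrink_0 group_step_unregularized
          diag pos \<alpha>_pos r_def del: One_nat_def)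
  qed
  have z_eq: "z t $ i = - (r t i / \<alpha> t * x (t + 1) $ i)" if "t \<le> T" for t i
  proof (cases "t = 0")
    case True
    then show ?thesis by (simp add: z_init V_init r_def)
  next
    case False
    then show ?thesis
      using that pos [of t i] \<alpha>_pos [of t] x_next [of t i] by (simp add: r_def)
  qed
  fix t assume "t \<in> {1..T}"
  then have t: "1 \<le> t" "t \<le> T" by auto
  have z_t: "z t $ i = m t $ i - r t i / \<alpha> t * x t $ i" for i
  proof -
    \<comment> \<open>Since \<open>1 \<le> t\<close>, subtraction is not truncated, and
      \<open>z_eq\<close> at \<open>t - 1\<close> speaks of \<open>x t\<close>, the vector that
      \<open>Q t\<close> acts on.\<close>
    have "t - 1 \<le> T" "t - 1 + 1 = t" using t by auto
    have "(Q t /\<^sub>R \<alpha> t) *v x t = (\<chi> i. (r t i / \<alpha> t - r (t - 1) i / \<alpha> (t - 1)) * x t $ i)"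
      unfolding Q_step [OF t] root [OF t(2)] root [OF \<open>t - 1 \<le> T\<close>]
      by (simp add: matrix_vector_mult_diff_rdistrib scaleR_matrix_vector_assoc [symmetric]
          diagonal_matrix_mult_vec vec_eq_iff left_diff_distrib divide_inverse)
    moreover have "z (t - 1) $ i = - (r (t - 1) i / \<alpha> (t - 1) * x t $ i)"
      using z_eq [OF \<open>t - 1 \<le> T\<close>, of i] unfolding \<open>t - 1 + 1 = t\<close> .
    ultimately show ?thesis
      by (simp add: z_step [OF t] left_diff_distrib)
  qed
  have r_nz: "r t i \<noteq> 0" for i
    using pos [OF t, of i] by (simp add: r_def)
  \<comment> \<open>The factor \<open>\<alpha> t / r t i\<close> cancels
    \<open>r t i / \<alpha> t\<close> in \<open>z_t\<close>, which leaves exactly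
    \<open>x t $ i\<close>.\<close>
  have "x (t + 1) $ i = x t $ i - \<alpha> t * (inverse (r t i) * m t $ i)" for i
    unfolding x_next [OF t] z_t using r_nz [of i] \<alpha>_pos [OF t(2)]
    by (simp add: right_diff_distrib) (simp add: divide_inverse)
  then show "x (t + 1) = x t - \<alpha> t *\<^sub>R (matrix_inv (sqrt_matrix (V t)) *v m t)"
    unfolding root [OF t(2)] matrix_inv_diagonal [of "r t", OF r_nz] diagonal_matrix_mult_vec
    by (simp add: vec_eq_iff)
qed

end
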